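(* Let $A$ be a complex $\ast$-algebra with a spanning semigroup $S$ containing a set of local projections for $A$. If there is an $S$-contractive faithful trace $\tau$ on $A$, then: (1) $\tau(e)>0$ (in particular $\tau(e)$ is real) for all nonzero idempotents $e\in A$; (2) $A$ is stably finite.
   Context: Algebras are not assumed unital. A ring $R$ is Dedekind finite if for every idempotent $e\in R$ and all $u,v\in eRe$, $uv=e$ implies $vu=e$; $R$ is stably finite if $M_n(R)$ is Dedekind finite for all $n\geq 1$. A $\ast$-algebra is a complex algebra $A$ with a map $\ast$ satisfying $(a+b)^\ast=a^\ast+b^\ast$, $(ab)^\ast=b^\ast a^\ast$, $(a^\ast)^\ast=a$, $(ca)^\ast=\overline c\,a^\ast$ for $a,b\in A$, $c\in\mathbb C$. A spanning semigroup for $A$ is a multiplicative subsemigroup $S\subseteq A$ closed under $\ast$ that spans $A$ as a vector space. A projection is an idempotent $p$ with $p^\ast=p$. $S$ contains a set of local projections for $A$ if for every finite subset $F\subseteq A$ there is a projection $p\in S$ with $F\subseteq pAp$. A trace on $A$ is a linear functional $\tau\colon A\to\mathbb C$ with $\tau(ab)=\tau(ba)$, $\tau(a^\ast)=\overline{\tau(a)}$ and $\tau(aa^\ast)\geq 0$ for all $a,b\in A$; it is faithful if $\tau(aa^\ast)=0$ implies $a=0$; it is $S$-contractive if $\tau(as(as)^\ast)\leq\tau(aa^\ast)$ for all $a\in A$, $s\in S$. *)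

theory Defs
  imports
    "HOL-Library.Complex_Order"
    "Jordan_Normal_Form.Matrix"
begin

(* In a non-unital ring this is literally {e r e | r in R}, with no identity added. *)
definition corner :: "'r::times set \<Rightarrow> 'r \<Rightarrow> 'r set" where
  "corner R e = {e * r * e | r. r \<in> R}"

(* The ring is given by its carrier R, and only its multiplication matters. This lets the same
   notion apply to a ring type (R = UNIV) and to the n x n matrices inside the type 'a mat, which
   contains the matrices of all sizes and is not itself a ring. *)
definition dedekind_finite :: "'r::times set \<Rightarrow> bool" where
  "dedekind_finite R \<longleftrightarrow>
     (\<forall>e\<in>R. e * e = e \<longrightarrow>
        (\<forall>u\<in>corner R e. \<forall>v\<in>corner R e. u * v = e \<longrightarrow> v * u = e))"

definition stably_finite :: "'a::ring set \<Rightarrow> bool" where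
  "stably_finite R \<longleftrightarrow>
     (\<forall>n\<ge>1. dedekind_finite {M \<in> carrier_mat n n. elements_mat M \<subseteq> R})"

(* The type class ring is the class of associative rings with no unit assumed. The complex scalar
   multiplication is an explicit parameter, as there is no type class of non-unital complex
   algebras. *)
locale star_algebra = vector_space scale
  for scale :: "complex \<Rightarrow> 'a::ring \<Rightarrow> 'a" (infixr \<open>*s\<close> 75) +
  fixes star :: "'a \<Rightarrow> 'a"
  assumes scale_mult_left: "(c *s a) * b = c *s (a * b)"
    and scale_mult_right: "a * (c *s b) = c *s (a * b)"
    and star_add: "star (a + b) = star a + star b"
    and star_mult: "star (a * b) = star b * star a"
    and star_star: "star (star a) = a"
    and star_scale: "star (c *s a) = cnj c *s star a"
begin

definition spanning_semigroup :: "'a set \<Rightarrow> bool" where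
  "spanning_semigroup S \<longleftrightarrow>
     (\<forall>s\<in>S. \<forall>t\<in>S. s * t \<in> S) \<and> (\<forall>s\<in>S. star s \<in> S) \<and> span S = UNIV"

definition projection :: "'a \<Rightarrow> bool" where
  "projection p \<longleftrightarrow> p * p = p \<and> star p = p"

definition contains_local_projections :: "'a set \<Rightarrow> bool" where
  "contains_local_projections S \<longleftrightarrow>
     (\<forall>F. finite F \<longrightarrow> (\<exists>p\<in>S. projection p \<and> F \<subseteq> corner UNIV p))"

(* Here and below, \<le> and < on complex are those of Complex_Order: w \<le> z means Re w \<le> Re z and
   Im w = Im z, and likewise for <. In particular 0 \<le> z and 0 < z entail that z is real. *)
definition trace :: "('a \<Rightarrow> complex) \<Rightarrow> bool" where
  "trace \<tau> \<longleftrightarrow>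
     Vector_Spaces.linear scale (*) \<tau> \<and>
     (\<forall>a b. \<tau> (a * b) = \<tau> (b * a)) \<and>
     (\<forall>a. \<tau> (star a) = cnj (\<tau> a)) \<and>
     (\<forall>a. 0 \<le> \<tau> (a * star a))"

definition faithful :: "('a \<Rightarrow> complex) \<Rightarrow> bool" where
  "faithful \<tau> \<longleftrightarrow> (\<forall>a. \<tau> (a * star a) = 0 \<longrightarrow> a = 0)"

definition contractive :: "'a set \<Rightarrow> ('a \<Rightarrow> complex) \<Rightarrow> bool" where
  "contractive S \<tau> \<longleftrightarrow>
     (\<forall>a. \<forall>s\<in>S. \<tau> ((a * s) * star (a * s)) \<le> \<tau> (a * star a))"

end

end

theory Submission
  imports Defs
begin

text \<open>The spanning semigroup of contractions makes every right multiplication bounded for the norm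
  \<open>\<tau> (a * star a)\<close>. For an idempotent \<open>e\<close>, the iteration
  \<open>w 0 = e\<close>, \<open>w (n + 1) = w n - r * w n * star e * e\<close> with small \<open>r > 0\<close> contracts to \<open>0\<close>
  in this norm, so that the telescoping sum gives \<open>\<tau> e = r * (\<Sum>n. \<tau> (w n * star e))\<close>. All
  terms are nonnegative and the first is \<open>\<tau> (e * star e) > 0\<close>. If \<open>u * v = e\<close> in a corner,
  then \<open>e - v * u\<close> is an idempotent of trace \<open>0\<close>, hence zero. Boundedness, faithfulness and the
  trace property pass to matrices over the algebra.\<close>

subsection \<open>Traces with bounded right multiplications\<close>

locale traced_star_algebra = star_algebra scale star
  for scale :: "complex \<Rightarrow> 'a::ring \<Rightarrow> 'a" (infixr \<open>*s\<close> 75) and star :: "'a \<Rightarrow> 'a" +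
  fixes \<tau> :: "'a \<Rightarrow> complex"
  assumes trace: "trace \<tau>"
begin

lemma tr_add: "\<tau> (a + b) = \<tau> a + \<tau> b"
  and tr_scale: "\<tau> (c *s a) = c * \<tau> a"
  using trace by (auto simp: trace_def Vector_Spaces.linear_iff)

lemma tr_0 [simp]: "\<tau> 0 = 0"
  using tr_add[of 0 0] by simp

lemma tr_diff: "\<tau> (a - b) = \<tau> a - \<tau> b"
  using tr_add[of "a - b" b] by simp

lemma tr_commute: "\<tau> (a * b) = \<tau> (b * a)"
  and tr_star: "\<tau> (star a) = cnj (\<tau> a)"
  and tr_nonneg: "0 \<le> \<tau> (a * star a)"
  using trace by (auto simp: trace_def)

lemma star_0 [simp]: "star 0 = 0"
  using star_add[of 0 0] by simp

lemma star_diff: "star (a - b) = star a - star b"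
  using star_add[of "a - b" b] by simp

text \<open>The square of the seminorm given by the positive form
  \<open>\<tau> (a * star b)\<close>. Keeping the square avoids roots in all estimates.\<close>

definition sqnorm :: "'a \<Rightarrow> real" where
  "sqnorm a = Re (\<tau> (a * star a))"

lemma tr_self: "\<tau> (a * star a) = of_real (sqnorm a)"
  using tr_nonneg[of a] by (simp add: sqnorm_def complex_eq_iff less_eq_complex_def)

lemma sqnorm_nonneg: "0 \<le> sqnorm a"
  using tr_nonneg[of a] by (simp add: sqnorm_def less_eq_complex_def)

lemma sqnorm_0 [simp]: "sqnorm 0 = 0"
  by (simp add: sqnorm_def)

lemma sqnorm_star: "sqnorm (star a) = sqnorm a"
  by (simp add: sqnorm_def star_star tr_commute)

lemma sqnorm_scale: "sqnorm (c *s a) = (cmod c)\<^sup>2 * sqnorm a"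
proof -
  have "\<tau> ((c *s a) * star (c *s a)) = (c * cnj c) * \<tau> (a * star a)"
    by (simp add: star_scale scale_mult_left scale_mult_right tr_scale)
  also have "\<dots> = of_real ((cmod c)\<^sup>2 * sqnorm a)"
    by (simp only: tr_self of_real_mult complex_norm_square)
  finally show ?thesis
    by (simp add: sqnorm_def)
qed

lemma Re_tr_swap: "Re (\<tau> (b * star a)) = Re (\<tau> (a * star b))"
proof -
  have "b * star a = star (a * star b)"
    by (simp add: star_mult star_star)
  then show ?thesis
    by (simp add: tr_star)
qed

lemma sqnorm_add: "sqnorm (a + b) = sqnorm a + 2 * Re (\<tau> (a * star b)) + sqnorm b"
  using Re_tr_swap[of a b] by (simp add: sqnorm_def star_add algebra_simps tr_add)

lemma sqnorm_diff: "sqnorm (a - b) = sqnorm a - 2 * Re (\<tau> (a * star b)) + sqnorm b"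
  using Re_tr_swap[of a b] by (simp add: sqnorm_def star_diff algebra_simps tr_add tr_diff)

text \<open>By the parallelogram law. It takes the place of the triangle inequality for squared
  norms.\<close>

lemma sqnorm_add_le: "sqnorm (a + b) \<le> 2 * sqnorm a + 2 * sqnorm b"
  using sqnorm_add[of a b] sqnorm_diff[of a b] sqnorm_nonneg[of "a - b"] by linarith

text \<open>Cauchy-Schwarz in additive form: expand the squares of \<open>a + star b\<close> and
  \<open>a - star b\<close>, and use that \<open>b\<close> and \<open>star b\<close> have equal
  norm.\<close>

lemma abs_Re_tr_mult_le: "2 * \<bar>Re (\<tau> (a * b))\<bar> \<le> sqnorm a + sqnorm b"
  using sqnorm_add[of a "star b"] sqnorm_diff[of a "star b"]
    sqnorm_nonneg[of "a - star b"] sqnorm_nonneg[of "a + star b"]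
  by (simp add: star_star sqnorm_star)

text \<open>Rotating \<open>a\<close> by the imaginary unit turns imaginary parts into real
  parts.\<close>

lemma abs_Im_tr_mult_le: "2 * \<bar>Im (\<tau> (a * b))\<bar> \<le> sqnorm a + sqnorm b"
proof -
  have "Re (\<tau> ((\<i> *s a) * b)) = - Im (\<tau> (a * b))"
    by (simp add: scale_mult_left tr_scale)
  then show ?thesis
    using abs_Re_tr_mult_le[of "\<i> *s a" b] by (simp add: sqnorm_scale)
qed

text \<open>\<open>C\<close> bounds the square of the operator norm of right multiplication by
  \<open>b\<close>.\<close>

definition right_bounded :: "'a \<Rightarrow> bool" where
  "right_bounded b \<longleftrightarrow> (\<exists>C\<ge>0. \<forall>x. sqnorm (x * b) \<le> C * sqnorm x)"

lemma right_bounded_0: "right_bounded 0"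
  unfolding right_bounded_def by (rule exI[of _ 0]) simp

lemma right_bounded_add:
  assumes "right_bounded a" "right_bounded b"
  shows "right_bounded (a + b)"
proof -
  from assms obtain C D where *: "C \<ge> 0" "D \<ge> 0"
    and C: "\<And>x. sqnorm (x * a) \<le> C * sqnorm x" and D: "\<And>x. sqnorm (x * b) \<le> D * sqnorm x"
    unfolding right_bounded_def by auto
  have "sqnorm (x * (a + b)) \<le> (2 * C + 2 * D) * sqnorm x" for x
    using sqnorm_add_le[of "x * a" "x * b"] C[of x] D[of x] by (simp add: algebra_simps)
  with * show ?thesis
    unfolding right_bounded_def by (intro exI[of _ "2 * C + 2 * D"]) auto
qed

lemma right_bounded_scale:
  assumes "right_bounded a"
  shows "right_bounded (c *s a)"
proof -
  from assms obtain C where *: "C \<ge> 0" and C: "\<And>x. sqnorm (x * a) \<le> C * sqnorm x"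
    unfolding right_bounded_def by auto
  have "sqnorm (x * (c *s a)) \<le> ((cmod c)\<^sup>2 * C) * sqnorm x" for x
    using mult_left_mono[OF C[of x], of "(cmod c)\<^sup>2"]
    by (simp add: scale_mult_right sqnorm_scale mult.assoc)
  with * show ?thesis
    unfolding right_bounded_def by (intro exI[of _ "(cmod c)\<^sup>2 * C"]) auto
qed

text \<open>Elements of \<open>S\<close> are bounded with constant 1, and the bounded elements form
  a subspace, which therefore contains the span of \<open>S\<close>.\<close>

lemma contractive_imp_right_bounded:
  assumes S: "spanning_semigroup S" and contr: "contractive S \<tau>"
  shows "right_bounded a"
proof -
  have "a \<in> span S"
    using S by (simp add: spanning_semigroup_def)
  then show ?thesis
  proof (induction rule: span_induct_alt)
    case base
    show ?case by (rule right_bounded_0)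
  next
    case (step c s b)
    have "sqnorm (x * s) \<le> 1 * sqnorm x" for x
      using contr step(1) by (simp add: contractive_def sqnorm_def less_eq_complex_def)
    then have "right_bounded s"
      unfolding right_bounded_def by (intro exI[of _ 1]) auto
    with step(2) show ?case
      by (intro right_bounded_add right_bounded_scale)
  qed
qed

end

section \<open>Decay of the iterates attached to an idempotent\<close>

text \<open>In an operator completion with unit, put
  \<open>z = 1 + (e - star e) * (star e - e)\<close> for the idempotent \<open>e\<close>. Then \<open>e\<close> commutes with \<open>z\<close> and
  \<open>e * z = e * star e * e\<close>, so that the iterate below is \<open>w n = e * (1 - r * z) ^ n\<close>, while
  \<open>e - w n\<close> has the same trace as the polynomial approximation
  \<open>1 - (1 - r * e * star e) ^ n\<close> to the range projection of \<open>e\<close>.\<close>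

locale idempotent_iteration = traced_star_algebra scale star \<tau>
  for scale :: "complex \<Rightarrow> 'a::ring \<Rightarrow> 'a" (infixr \<open>*s\<close> 75) and star :: "'a \<Rightarrow> 'a" and \<tau> +
  fixes e :: 'a and r C :: real
  assumes idem: "e * e = e"
    and bound_e: "\<And>x. sqnorm (x * e) \<le> C * sqnorm x"
    and bound_star: "\<And>x. sqnorm (x * star e) \<le> C * sqnorm x"
    and r_pos: "0 < r" and r_C: "r * C \<le> 1" and r_lt_1: "r < 1"
begin

primrec w :: "nat \<Rightarrow> 'a" where
  "w 0 = e"
| "w (Suc n) = w n - of_real r *s (w n * star e * e)"

lemmas scale_simps = scale_mult_left scale_mult_right scale_right_diff_distrib

lemma w_e: "w n * e = w n"
  by (induction n) (simp_all add: idem left_diff_distrib scale_simps mult.assoc)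

lemma e_w: "e * w n = w n"
proof (induction n)
  case (Suc n)
  have "e * (w n * star e * e) = (e * w n) * star e * e"
    by (simp add: mult.assoc)
  then show ?case
    using Suc by (simp add: right_diff_distrib scale_simps)
qed (simp add: idem)

text \<open>As \<open>e\<close> fixes \<open>w n\<close> on both sides, both products multiply
  \<open>w n\<close> by \<open>e * star e * e\<close>, and \<open>w n\<close> is a polynomial in
  this element.\<close>

lemma w_commute: "w n * star e * e = e * star e * w n"
proof (induction n)
  case (Suc n)
  have "w (Suc n) * star e * e
      = w n * star e * e - of_real r *s ((w n * star e * e) * star e * e)"
    by (simp add: left_diff_distrib scale_simps)
  also have "\<dots> = e * star e * w n - of_real r *s (e * star e * w n * star e * e)"
    by (simp only: Suc)
  also have "\<dots> = e * star e * w (Suc n)"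
    by (simp add: right_diff_distrib scale_simps mult.assoc)
  finally show ?case .
qed simp

text \<open>The iterates are the powers of \<open>w 1\<close> in the corner whose unit is
  \<open>w 0 = e\<close>.\<close>

lemma w_add: "w (m + n) = w m * w n"
proof (induction n)
  case 0
  show ?case by (simp add: w_e)
next
  case (Suc n)
  then show ?case
    by (simp add: right_diff_distrib scale_simps mult.assoc)
qed

text \<open>Formally both sides are \<open>e * (1 - r * z) ^ n * star e\<close>, because
  \<open>z\<close> is self-adjoint. The induction avoids adjoining a unit.\<close>

lemma w_star: "w n * star e = e * star (w n)"
proof (induction n)
  case (Suc n)
  have "w (Suc n) * star e = w n * star e - of_real r *s (w n * star e * e * star e)"
    by (simp add: left_diff_distrib scale_simps)
  also have "\<dots> = w n * star e - of_real r *s (e * star e * (w n * star e))"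
    by (simp only: w_commute) (simp only: mult.assoc)
  also have "\<dots> = e * star (w n) - of_real r *s (e * star e * (e * star (w n)))"
    by (simp only: Suc)
  also have "\<dots> = e * star (w (Suc n))"
    by (simp add: right_diff_distrib scale_simps star_diff star_scale star_mult star_star mult.assoc)
  finally show ?case .
qed simp

lemma tr_w_star: "\<tau> (w (m + n) * star e) = \<tau> (w m * star (w n))"
proof -
  have "w (m + n) * star e = (w m * e) * star (w n)"
    by (simp add: w_add w_star mult.assoc)
  then show ?thesis
    by (simp add: w_e)
qed

text \<open>An even index splits into halves and gives \<open>\<tau> (w j * star (w j))\<close>. An
  odd index leaves a correction of first order in \<open>r\<close>, which
  \<open>r * C \<le> 1\<close> keeps below the main term.\<close>

lemma tr_w_star_nonneg: "0 \<le> \<tau> (w n * star e)"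
proof (cases "even n")
  case True
  then obtain j where "n = j + j"
    by (metis evenE mult_2)
  then show ?thesis
    by (simp only: tr_w_star tr_nonneg)
next
  case False
  then obtain j where n: "n = Suc j + j"
    by (metis oddE mult_2 Suc_eq_plus1 add_Suc)
  have eq: "w j * star e * e * star (w j) = (w j * star e) * star (w j * star e)"
    by (simp add: star_mult star_star mult.assoc)
  have "\<tau> (w n * star e) = of_real (sqnorm (w j) - r * sqnorm (w j * star e))"
    unfolding n tr_w_star
    by (simp add: left_diff_distrib scale_simps tr_diff tr_scale eq tr_self)
  moreover have "r * sqnorm (w j * star e) \<le> sqnorm (w j)"
  proof -
    have "r * sqnorm (w j * star e) \<le> r * (C * sqnorm (w j))"
      using bound_star r_pos by (intro mult_left_mono) auto
    also have "\<dots> \<le> 1 * sqnorm (w j)"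
      using r_C mult_right_mono[OF r_C sqnorm_nonneg[of "w j"]] by (simp add: mult.assoc)
    finally show ?thesis by simp
  qed
  ultimately show ?thesis
    by (simp add: less_eq_complex_def)
qed

text \<open>Cyclicity brings the last \<open>e\<close> to the front, where \<open>w n\<close>
  absorbs it.\<close>

lemma tr_w_Suc: "\<tau> (w (Suc n)) = \<tau> (w n) - of_real r * \<tau> (w n * star e)"
proof -
  have "\<tau> (w n * star e * e) = \<tau> (e * w n * star e)"
    using tr_commute[of "w n * star e" e] by (simp add: mult.assoc)
  then show ?thesis
    by (simp add: tr_diff tr_scale e_w)
qed

text \<open>Every decrement is nonnegative, hence real.\<close>

lemma Im_tr_w: "Im (\<tau> (w n)) = Im (\<tau> e)"
proof (induction n)
  case (Suc n)
  then show ?case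
    using tr_w_star_nonneg[of n] by (simp add: tr_w_Suc less_eq_complex_def del: w.simps(2))
qed simp

text \<open>The first decrement is \<open>r * \<tau> (e * star e)\<close>; later ones can only lower
  the value further.\<close>

lemma Re_tr_w: "Re (\<tau> (w (Suc n))) \<le> Re (\<tau> e) - r * sqnorm e"
proof (induction n)
  case 0
  show ?case
    unfolding tr_w_Suc by (simp add: tr_self)
next
  case (Suc n)
  have "0 \<le> r * Re (\<tau> (w (Suc n) * star e))"
    using tr_w_star_nonneg[of "Suc n"] r_pos by (simp add: less_eq_complex_def del: w.simps(2))
  with Suc show ?case
    by (subst tr_w_Suc) (simp del: w.simps(2))
qed

text \<open>Since \<open>w n * e = w n\<close>, right multiplication by \<open>star e\<close> does
  not shorten \<open>w n\<close>. In the expanded square, half of the linear term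
  \<open>2 * r * sqnorm u\<close> absorbs the quadratic term, and the other half yields the factor
  \<open>1 - r\<close>.\<close>

lemma sqnorm_w_Suc: "sqnorm (w (Suc n)) \<le> (1 - r) * sqnorm (w n)"
proof -
  define u where "u = w n * star e"
  have eq: "w n * star (u * e) = u * star u"
    by (simp add: u_def star_mult star_star mult.assoc)
  \<comment> \<open>The inner product of \<open>w n\<close> with \<open>u\<close> is
    \<open>sqnorm (w n)\<close>, so \<open>u - w n\<close> is orthogonal to
    \<open>w n\<close>.\<close>
  have "w n * star u = w n * e * star (w n)"
    by (simp add: u_def star_mult star_star mult.assoc)
  then have "sqnorm (w n - u) = sqnorm (w n) - 2 * sqnorm (w n) + sqnorm u"
    by (subst sqnorm_diff) (simp add: w_e sqnorm_def)
  then have le: "sqnorm (w n) \<le> sqnorm u"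
    using sqnorm_nonneg[of "w n - u"] by linarith
  have "sqnorm (w (Suc n)) = sqnorm (w n) - 2 * r * sqnorm u + r\<^sup>2 * sqnorm (u * e)"
    using r_pos
    by (simp add: u_def[symmetric] sqnorm_diff star_scale scale_simps tr_scale eq tr_self sqnorm_scale)
  moreover have "r\<^sup>2 * sqnorm (u * e) \<le> r * sqnorm u"
  proof -
    have "r\<^sup>2 * sqnorm (u * e) \<le> r\<^sup>2 * (C * sqnorm u)"
      by (intro mult_left_mono bound_e) simp
    also have "\<dots> = r * ((r * C) * sqnorm u)"
      by (simp add: power2_eq_square)
    also have "\<dots> \<le> r * (1 * sqnorm u)"
      using r_pos r_C by (intro mult_left_mono mult_right_mono sqnorm_nonneg) auto
    finally show ?thesis by simp
  qed
  moreover have "r * sqnorm (w n) \<le> r * sqnorm u"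
    using le r_pos by simp
  ultimately show ?thesis
    by (simp add: algebra_simps del: w.simps)
qed

lemma sqnorm_w: "sqnorm (w n) \<le> (1 - r) ^ n * sqnorm e"
proof (induction n)
  case (Suc n)
  have "sqnorm (w (Suc n)) \<le> (1 - r) * ((1 - r) ^ n * sqnorm e)"
    using sqnorm_w_Suc[of n] mult_left_mono[OF Suc, of "1 - r"] r_lt_1 by linarith
  then show ?case by simp
qed simp

lemma sqnorm_w_tendsto: "(\<lambda>n. sqnorm (w n)) \<longlonglongrightarrow> 0"
proof (rule tendsto_sandwich[OF _ _ tendsto_const])
  show "(\<lambda>n. (1 - r) ^ n * sqnorm e) \<longlonglongrightarrow> 0"
    using r_pos r_lt_1 by (intro tendsto_mult_left_zero LIMSEQ_realpow_zero) auto
qed (auto simp: sqnorm_nonneg sqnorm_w)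

text \<open>The factorization \<open>w (n + n) = w n * w n\<close> bounds the constant imaginary
  part by \<open>sqnorm (w n)\<close>, which tends to 0.\<close>

lemma Im_tr_idempotent: "Im (\<tau> e) = 0"
proof -
  have "\<bar>Im (\<tau> e)\<bar> \<le> sqnorm (w n)" for n
    using abs_Im_tr_mult_le[of "w n" "w n"] Im_tr_w[of "n + n"] by (simp add: w_add)
  then have "\<bar>Im (\<tau> e)\<bar> \<le> 0"
    by (intro LIMSEQ_le_const[OF sqnorm_w_tendsto]) auto
  then show ?thesis by simp
qed

lemma Re_tr_idempotent: "r * sqnorm e \<le> Re (\<tau> e)"
proof -
  \<comment> \<open>For positive \<open>n\<close> the index \<open>n + n\<close> is a successor, so
    the first decrement has already been subtracted.\<close>
  have "r * sqnorm e - Re (\<tau> e) \<le> sqnorm (w n)" if "n \<ge> 1" for n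
  proof -
    from that obtain m where "n + n = Suc m"
      by (cases n) auto
    then show ?thesis
      using abs_Re_tr_mult_le[of "w n" "w n"] Re_tr_w[of m] w_add[of n n] by (simp del: w.simps)
  qed
  then have "r * sqnorm e - Re (\<tau> e) \<le> 0"
    by (intro LIMSEQ_le_const[OF sqnorm_w_tendsto]) auto
  then show ?thesis by simp
qed

end

section \<open>Positivity on idempotents and Dedekind finiteness\<close>

locale bounded_traced_star_algebra = traced_star_algebra scale star \<tau>
  for scale :: "complex \<Rightarrow> 'a::ring \<Rightarrow> 'a" (infixr \<open>*s\<close> 75) and star :: "'a \<Rightarrow> 'a" and \<tau> +
  assumes faithful: "faithful \<tau>"
    and right_bounded: "right_bounded a"
begin

lemma sqnorm_eq_0_iff: "sqnorm a = 0 \<longleftrightarrow> a = 0"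
  using faithful tr_self[of a] by (auto simp: faithful_def)

lemma tr_idempotent_pos:
  assumes "e * e = e" "e \<noteq> 0"
  shows "0 < \<tau> e"
proof -
  obtain C D where "C \<ge> 0" "D \<ge> 0" and C: "\<And>x. sqnorm (x * e) \<le> C * sqnorm x"
    and D: "\<And>x. sqnorm (x * star e) \<le> D * sqnorm x"
    using right_bounded[of e] right_bounded[of "star e"] unfolding right_bounded_def by auto
  \<comment> \<open>A common bound for both multiplications, enlarged so that the step size
    \<open>1 / K\<close> is below 1.\<close>
  define K where "K = C + D + 2"
  have "sqnorm (x * e) \<le> K * sqnorm x" "sqnorm (x * star e) \<le> K * sqnorm x" for x
    using C[of x] D[of x] mult_right_mono[OF _ sqnorm_nonneg[of x], of C K]
      mult_right_mono[OF _ sqnorm_nonneg[of x], of D K] \<open>C \<ge> 0\<close> \<open>D \<ge> 0\<close>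
    by (auto simp: K_def)
  moreover have "K \<ge> 2"
    using \<open>C \<ge> 0\<close> \<open>D \<ge> 0\<close> by (simp add: K_def)
  ultimately interpret idempotent_iteration scale star \<tau> e "1 / K" K
    using assms by unfold_locales auto
  have "sqnorm e > 0"
    using sqnorm_eq_0_iff[of e] sqnorm_nonneg[of e] assms by linarith
  then have "0 < 1 / K * sqnorm e"
    using \<open>K \<ge> 2\<close> by simp
  with Re_tr_idempotent Im_tr_idempotent show ?thesis
    by (simp add: less_complex_def)
qed

text \<open>The idempotent \<open>e - v * u\<close> has trace
  \<open>\<tau> (u * v) - \<tau> (v * u) = 0\<close>, so positivity forces it to vanish.\<close>

lemma dedekind_finite_UNIV: "dedekind_finite (UNIV :: 'a set)"
proof -
  have "v * u = e" if "e * e = e" "u \<in> corner UNIV e" "v \<in> corner UNIV e" "u * v = e" for e u v :: 'a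
  proof -
    have corner: "e * x = x \<and> x * e = x" if "x \<in> corner UNIV e" for x
    proof -
      from that obtain y where x: "x = e * y * e"
        by (auto simp: corner_def)
      show ?thesis
        using \<open>e * e = e\<close> unfolding x by (metis mult.assoc)
    qed
    have vu: "v * u * (v * u) = v * u"
      using that corner by (metis mult.assoc)
    have "e * (v * u) = v * u" "v * u * e = v * u"
      using that corner by (metis mult.assoc)+
    then have "(e - v * u) * (e - v * u) = e - v * u"
      using vu \<open>e * e = e\<close> by (simp add: algebra_simps)
    moreover have "\<tau> (e - v * u) = 0"
      using \<open>u * v = e\<close> tr_commute[of u v] by (simp add: tr_diff)
    ultimately have "e - v * u = 0"
      using tr_idempotent_pos[of "e - v * u"] by auto
    then show ?thesis by simp
  qed
  then show ?thesis
    unfolding dedekind_finite_def by blast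
qed

end

subsection \<open>Finitely supported infinite matrices\<close>

text \<open>These form a ring type containing \<open>carrier_mat n n\<close> for every \<open>n\<close>, whereas
  the type \<open>'a mat\<close> is no ring.\<close>

typedef (overloaded) 'a fmat =
  "{f :: nat \<Rightarrow> nat \<Rightarrow> 'a::zero. \<exists>n. \<forall>i j. n \<le> i \<or> n \<le> j \<longrightarrow> f i j = 0}"
  morphisms entry Abs_fmat
  by (rule exI[of _ "\<lambda>_ _. 0"]) simp

setup_lifting type_definition_fmat

lemma fmat_eqI: "(\<And>i j. entry M i j = entry N i j) \<Longrightarrow> M = N"
  by (simp add: entry_inject[symmetric] fun_eq_iff)

definition fits :: "nat \<Rightarrow> 'a::zero fmat \<Rightarrow> bool" where
  "fits n M \<longleftrightarrow> (\<forall>i j. n \<le> i \<or> n \<le> j \<longrightarrow> entry M i j = 0)"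

lemma fitsD: "fits n M \<Longrightarrow> n \<le> i \<or> n \<le> j \<Longrightarrow> entry M i j = 0"
  unfolding fits_def by blast

lemma fits_mono: "fits m M \<Longrightarrow> m \<le> n \<Longrightarrow> fits n M"
  unfolding fits_def by (meson le_trans)

lemma fits_exists: "\<exists>n. fits n M"
  using entry[of M] by (simp add: fits_def)

lemma fits_exists2: obtains n where "fits n M" "fits n N"
proof -
  obtain m n where "fits m M" "fits n N"
    using fits_exists by metis
  then show ?thesis
    using that[of "max m n"] fits_mono by (metis max.cobounded1 max.cobounded2)
qed

lemma fits_exists3: obtains n where "fits n L" "fits n M" "fits n N"
proof -
  obtain m n where "fits m L" "fits m M" "fits n N"
    using fits_exists2[of L M] fits_exists[of N] by metis
  then show ?thesis
    using that[of "max m n"] fits_mono by (metis max.cobounded1 max.cobounded2)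
qed

instantiation fmat :: (ring) ring
begin

lift_definition zero_fmat :: "'a fmat" is "\<lambda>_ _. 0"
  by simp

lift_definition plus_fmat :: "'a fmat \<Rightarrow> 'a fmat \<Rightarrow> 'a fmat" is "\<lambda>f g i j. f i j + g i j"
proof -
  fix f g :: "nat \<Rightarrow> nat \<Rightarrow> 'a"
  assume "\<exists>n. \<forall>i j. n \<le> i \<or> n \<le> j \<longrightarrow> f i j = 0" "\<exists>n. \<forall>i j. n \<le> i \<or> n \<le> j \<longrightarrow> g i j = 0"
  then obtain m n where "\<forall>i j. m \<le> i \<or> m \<le> j \<longrightarrow> f i j = 0" "\<forall>i j. n \<le> i \<or> n \<le> j \<longrightarrow> g i j = 0"
    by blast
  then show "\<exists>n. \<forall>i j. n \<le> i \<or> n \<le> j \<longrightarrow> f i j + g i j = 0"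
    by (intro exI[of _ "max m n"]) auto
qed

lift_definition uminus_fmat :: "'a fmat \<Rightarrow> 'a fmat" is "\<lambda>f i j. - f i j"
  by simp

definition minus_fmat :: "'a fmat \<Rightarrow> 'a fmat \<Rightarrow> 'a fmat" where
  "minus_fmat M N = M + - N"

text \<open>Summing over the nonzero entries in row \<open>i\<close> of \<open>f\<close> states the
  product without choosing a size; the support condition makes this range finite.\<close>

lift_definition times_fmat :: "'a fmat \<Rightarrow> 'a fmat \<Rightarrow> 'a fmat" is
  "\<lambda>f g i j. \<Sum>k | f i k \<noteq> 0. f i k * g k j"
proof -
  fix f g :: "nat \<Rightarrow> nat \<Rightarrow> 'a"
  assume "\<exists>n. \<forall>i j. n \<le> i \<or> n \<le> j \<longrightarrow> f i j = 0" "\<exists>n. \<forall>i j. n \<le> i \<or> n \<le> j \<longrightarrow> g i j = 0"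
  then obtain m n where *: "\<forall>i j. m \<le> i \<or> m \<le> j \<longrightarrow> f i j = 0" "\<forall>i j. n \<le> i \<or> n \<le> j \<longrightarrow> g i j = 0"
    by blast
  show "\<exists>n. \<forall>i j. n \<le> i \<or> n \<le> j \<longrightarrow> (\<Sum>k | f i k \<noteq> 0. f i k * g k j) = 0"
    by (rule exI[of _ "max m n"]) (auto simp: * intro!: sum.neutral)
qed

lemma entry_times_left:
  assumes "fits n M"
  shows "entry (M * N) i j = (\<Sum>k<n. entry M i k * entry N k j)"
  unfolding times_fmat.rep_eq
  by (rule sum.mono_neutral_left) (auto simp: not_le[symmetric] fitsD[OF assms])

text \<open>A range large enough for \<open>M\<close> is taken first; the terms beyond
  \<open>n\<close> then vanish because of \<open>N\<close>.\<close>

lemma entry_times_right: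
  assumes "fits n N"
  shows "entry (M * N) i j = (\<Sum>k<n. entry M i k * entry N k j)"
proof -
  obtain m where m: "fits m M" "fits m N"
    by (rule fits_exists2)
  have "entry (M * N) i j = (\<Sum>k<max m n. entry M i k * entry N k j)"
    by (rule entry_times_left) (rule fits_mono[OF m(1)], simp)
  also have "\<dots> = (\<Sum>k<n. entry M i k * entry N k j)"
    by (rule sum.mono_neutral_right) (auto simp: fitsD[OF assms])
  finally show ?thesis .
qed

instance
proof
  fix a b c :: "'a fmat"
  show "a * b * c = a * (b * c)"
  proof (rule fmat_eqI)
    fix i j
    obtain n where n: "fits n a" "fits n b" "fits n c"
      by (rule fits_exists3)
    have "entry (a * b * c) i j
        = (\<Sum>k<n. \<Sum>l<n. entry a i l * entry b l k * entry c k j)"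
      by (simp add: entry_times_right[OF n(3)] entry_times_left[OF n(1)] sum_distrib_right)
    also have "\<dots> = (\<Sum>l<n. \<Sum>k<n. entry a i l * entry b l k * entry c k j)"
      by (rule sum.swap)
    also have "\<dots> = entry (a * (b * c)) i j"
      by (simp add: entry_times_right[OF n(3)] entry_times_left[OF n(1)] sum_distrib_left mult.assoc)
    finally show "entry (a * b * c) i j = entry (a * (b * c)) i j" .
  qed
  show "a + b + c = a + (b + c)" "a + b = b + a" "0 + a = a" "- a + a = 0"
    by (transfer, simp add: fun_eq_iff add.assoc add.commute)+
  show "a - b = a + - b"
    by (simp add: minus_fmat_def)
  show "(a + b) * c = a * c + b * c"
  proof (rule fmat_eqI)
    fix i j
    obtain n where n: "fits n c"
      using fits_exists by blast
    show "entry ((a + b) * c) i j = entry (a * c + b * c) i j"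
      by (simp add: entry_times_right[OF n] plus_fmat.rep_eq distrib_right sum.distrib)
  qed
  show "a * (b + c) = a * b + a * c"
  proof (rule fmat_eqI)
    fix i j
    obtain n where n: "fits n a"
      using fits_exists by blast
    show "entry (a * (b + c)) i j = entry (a * b + a * c) i j"
      by (simp add: entry_times_left[OF n] plus_fmat.rep_eq distrib_left sum.distrib)
  qed
qed

end

section \<open>Embedding of square matrices\<close>

text \<open>Padding by zeros makes the map multiplicative on square matrices of one size.\<close>

lift_definition fmat_of_mat :: "'a::zero mat \<Rightarrow> 'a fmat" is
  "\<lambda>M i j. if i < dim_row M \<and> j < dim_col M then M $$ (i, j) else 0"
proof -
  fix M :: "'a mat"
  show "\<exists>n. \<forall>i j. n \<le> i \<or> n \<le> j \<longrightarrow>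
      (if i < dim_row M \<and> j < dim_col M then M $$ (i, j) else 0) = 0"
    by (rule exI[of _ "max (dim_row M) (dim_col M)"]) auto
qed

lemma fits_fmat_of_mat: "M \<in> carrier_mat n n \<Longrightarrow> fits n (fmat_of_mat M)"
  by (auto simp: fits_def fmat_of_mat.rep_eq)

lemma fmat_of_mat_times:
  fixes M N :: "'a::ring mat"
  assumes "M \<in> carrier_mat n n" "N \<in> carrier_mat n n"
  shows "fmat_of_mat (M * N) = fmat_of_mat M * fmat_of_mat N"
proof (rule fmat_eqI)
  fix i j
  have "entry (fmat_of_mat M * fmat_of_mat N) i j
      = (\<Sum>k<n. entry (fmat_of_mat M) i k * entry (fmat_of_mat N) k j)"
    by (rule entry_times_left[OF fits_fmat_of_mat[OF assms(1)]])
  also have "\<dots> = entry (fmat_of_mat (M * N)) i j"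
    using assms by (auto simp: fmat_of_mat.rep_eq scalar_prod_def atLeast0LessThan intro!: sum.cong)
  finally show "entry (fmat_of_mat (M * N)) i j = entry (fmat_of_mat M * fmat_of_mat N) i j" ..
qed

text \<open>The common size matters, since padding forgets it: zero matrices of all sizes have the
  same image.\<close>

lemma fmat_of_mat_inject:
  assumes "M \<in> carrier_mat n n" "N \<in> carrier_mat n n" "fmat_of_mat M = fmat_of_mat N"
  shows "M = N"
proof (rule eq_matI)
  fix i j assume "i < dim_row N" "j < dim_col N"
  then have "i < dim_row N" "j < dim_col N" "i < dim_row M" "j < dim_col M"
    using assms(1,2) by auto
  moreover have "entry (fmat_of_mat M) i j = entry (fmat_of_mat N) i j"
    by (simp only: assms(3))
  ultimately show "M $$ (i, j) = N $$ (i, j)"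
    by (simp add: fmat_of_mat.rep_eq)
qed (use assms in auto)

text \<open>On each \<open>carrier_mat n n\<close> padding is multiplicative and injective and sends
  corners into corners, so a single Dedekind finite ring serves all \<open>n\<close>.\<close>

lemma stably_finite_UNIV_if_dedekind_finite_fmat:
  assumes fin: "dedekind_finite (UNIV :: 'a::ring fmat set)"
  shows "stably_finite (UNIV :: 'a set)"
proof -
  have "v * u = e"
    if e: "e \<in> carrier_mat n n" "e * e = e"
      and u: "u \<in> corner (carrier_mat n n) e" and v: "v \<in> corner (carrier_mat n n) e"
      and uv: "u * v = e"
    for n and e u v :: "'a mat"
  proof -
    have corner: "x \<in> carrier_mat n n \<and> fmat_of_mat x \<in> corner UNIV (fmat_of_mat e)"
      if "x \<in> corner (carrier_mat n n) e" for x
    proof -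
      from that obtain y where y: "y \<in> carrier_mat n n" "x = e * y * e"
        by (auto simp: corner_def)
      then have "fmat_of_mat x = fmat_of_mat e * fmat_of_mat y * fmat_of_mat e"
        using e fmat_of_mat_times[of "e * y" n e] fmat_of_mat_times[of e n y] by simp
      with y e show ?thesis
        by (auto simp: corner_def)
    qed
    have carrier: "u \<in> carrier_mat n n" "v \<in> carrier_mat n n"
      using corner u v by auto
    have "fmat_of_mat e * fmat_of_mat e = fmat_of_mat e" "fmat_of_mat u * fmat_of_mat v = fmat_of_mat e"
      using fmat_of_mat_times[OF e(1) e(1)] fmat_of_mat_times[OF carrier] e(2) uv by simp_all
    then have "fmat_of_mat v * fmat_of_mat u = fmat_of_mat e"
      using fin corner[OF u] corner[OF v] unfolding dedekind_finite_def by blast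
    then have "fmat_of_mat (v * u) = fmat_of_mat e"
      by (simp only: fmat_of_mat_times[OF carrier(2,1)])
    then show ?thesis
      by (rule fmat_of_mat_inject[OF mult_carrier_mat[OF carrier(2,1)] e(1)])
  qed
  then have "dedekind_finite (carrier_mat n n :: 'a mat set)" for n
    unfolding dedekind_finite_def by (intro ballI impI)
  then show ?thesis
    by (simp add: stably_finite_def)
qed

section \<open>Star, trace and boundedness on matrices\<close>

text \<open>The case distinction keeps the support finite for every \<open>h\<close>; it has no
  effect when \<open>h 0 = 0\<close>.\<close>

lift_definition map_fmat :: "('a \<Rightarrow> 'a) \<Rightarrow> 'a::zero fmat \<Rightarrow> 'a fmat" is
  "\<lambda>h f i j. if f i j = 0 then 0 else h (f i j)"
  by auto

lift_definition transpose_fmat :: "'a::zero fmat \<Rightarrow> 'a fmat" is "\<lambda>f i j. f j i"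
  by blast

lemma entry_map_fmat: "h 0 = 0 \<Longrightarrow> entry (map_fmat h M) i j = h (entry M i j)"
  by (simp add: map_fmat.rep_eq)

text \<open>For additive \<open>t\<close> this is the usual matrix trace followed by
  \<open>t\<close>. Only finitely many diagonal entries are nonzero.\<close>

definition trace_fmat :: "('a \<Rightarrow> 'b) \<Rightarrow> 'a::zero fmat \<Rightarrow> 'b::comm_monoid_add" where
  "trace_fmat t M = (\<Sum>i | entry M i i \<noteq> 0. t (entry M i i))"

lemma trace_fmat_eq:
  assumes "fits n M" "t 0 = 0"
  shows "trace_fmat t M = (\<Sum>i<n. t (entry M i i))"
  unfolding trace_fmat_def
  by (rule sum.mono_neutral_left) (auto simp: assms not_le[symmetric] fitsD[OF assms(1)])

context bounded_traced_star_algebra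
begin

definition scale_fmat :: "complex \<Rightarrow> 'a fmat \<Rightarrow> 'a fmat" where
  "scale_fmat c = map_fmat (scale c)"

definition star_fmat :: "'a fmat \<Rightarrow> 'a fmat" where
  "star_fmat M = map_fmat star (transpose_fmat M)"

lemma star_sum: "star (sum f I) = (\<Sum>i\<in>I. star (f i))"
  by (induction I rule: infinite_finite_induct) (simp_all add: star_add)

lemma tr_sum: "\<tau> (sum f I) = (\<Sum>i\<in>I. \<tau> (f i))"
  by (induction I rule: infinite_finite_induct) (simp_all add: tr_add)

lemma entry_fmat_simps:
  "entry (0 :: 'a fmat) i j = 0"
  "entry (M + N) i j = entry M i j + entry N i j"
  "entry (scale_fmat c M) i j = c *s entry M i j"
  "entry (star_fmat M) i j = star (entry M j i)"
  by (simp_all add: zero_fmat.rep_eq plus_fmat.rep_eq scale_fmat_def star_fmat_def entry_map_fmat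
      transpose_fmat.rep_eq)

lemma fits_fmat_simps:
  assumes "fits n M"
  shows "fits n (scale_fmat c M)" "fits n (star_fmat M)" "fits n N \<Longrightarrow> fits n (M + N)"
    "fits n N \<Longrightarrow> fits n (M * N)"
proof -
  show "fits n (M * N)" if "fits n N"
    unfolding fits_def entry_times_left[OF assms]
    by (auto simp: fitsD[OF assms] fitsD[OF that] intro!: sum.neutral)
qed (use assms in \<open>auto simp: fits_def entry_fmat_simps\<close>)

lemma star_algebra_fmat: "star_algebra scale_fmat star_fmat"
proof
  fix M N :: "'a fmat" and c d :: complex
  obtain n where n: "fits n M" "fits n N"
    by (rule fits_exists2)
  show "scale_fmat c (M + N) = scale_fmat c M + scale_fmat c N"
    "scale_fmat (c + d) M = scale_fmat c M + scale_fmat d M"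
    "scale_fmat c (scale_fmat d M) = scale_fmat (c * d) M" "scale_fmat 1 M = M"
    "star_fmat (M + N) = star_fmat M + star_fmat N" "star_fmat (star_fmat M) = M"
    "star_fmat (scale_fmat c M) = scale_fmat (cnj c) (star_fmat M)"
    by (rule fmat_eqI, simp add: entry_fmat_simps scale_right_distrib scale_left_distrib star_add
        star_star star_scale)+
  note times = entry_times_left[OF n(1)] entry_times_left[OF fits_fmat_simps(1)[OF n(1)]]
    entry_times_left[OF fits_fmat_simps(2)[OF n(2)]]
  show "scale_fmat c M * N = scale_fmat c (M * N)" "M * scale_fmat c N = scale_fmat c (M * N)"
    "star_fmat (M * N) = star_fmat N * star_fmat M"
    by (rule fmat_eqI, simp add: times entry_fmat_simps scale_mult_left scale_mult_right
        scale_sum_right star_sum star_mult)+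
qed

sublocale fmat: star_algebra scale_fmat star_fmat
  by (rule star_algebra_fmat)

lemma trace_fmat_times:
  assumes "fits n M" "fits n N"
  shows "trace_fmat \<tau> (M * N) = (\<Sum>i<n. \<Sum>k<n. \<tau> (entry M i k * entry N k i))"
  using assms
  by (simp add: trace_fmat_eq[OF fits_fmat_simps(4)] entry_times_left[OF assms(1)] tr_sum)

text \<open>The Hilbert-Schmidt formula, which reduces positivity, faithfulness and boundedness on
  matrices to entries.\<close>

lemma trace_fmat_star:
  assumes "fits n M"
  shows "trace_fmat \<tau> (M * star_fmat M) = of_real (\<Sum>i<n. \<Sum>k<n. sqnorm (entry M i k))"
  by (simp add: trace_fmat_times[OF assms fits_fmat_simps(2)[OF assms]] entry_fmat_simps tr_self)

lemma traced_star_algebra_fmat: "traced_star_algebra scale_fmat star_fmat (trace_fmat \<tau>)"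
proof
  show "fmat.trace (trace_fmat \<tau>)"
    unfolding fmat.trace_def
  proof (intro conjI allI)
    have "vector_space ((*) :: complex \<Rightarrow> complex \<Rightarrow> complex)"
      by unfold_locales (simp_all add: algebra_simps)
    moreover have "trace_fmat \<tau> (M + N) = trace_fmat \<tau> M + trace_fmat \<tau> N" for M N
    proof -
      obtain n where n: "fits n M" "fits n N"
        by (rule fits_exists2)
      then show ?thesis
        by (simp add: trace_fmat_eq[of n] fits_fmat_simps entry_fmat_simps tr_add sum.distrib)
    qed
    moreover have "trace_fmat \<tau> (scale_fmat c M) = c * trace_fmat \<tau> M" for c M
    proof -
      obtain n where "fits n M"
        using fits_exists by blast
      then show ?thesis
        by (simp add: trace_fmat_eq[of n] fits_fmat_simps entry_fmat_simps tr_scale sum_distrib_left)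
    qed
    ultimately show "Vector_Spaces.linear scale_fmat (*) (trace_fmat \<tau>)"
      using fmat.vector_space_axioms by (simp add: Vector_Spaces.linear_iff)
    fix M N :: "'a fmat"
    obtain n where n: "fits n M" "fits n N"
      by (rule fits_exists2)
    \<comment> \<open>Exchanging the indices reduces cyclicity to that of \<open>\<tau>\<close> on
      single entries.\<close>
    have "trace_fmat \<tau> (M * N) = (\<Sum>k<n. \<Sum>i<n. \<tau> (entry M i k * entry N k i))"
      unfolding trace_fmat_times[OF n] by (rule sum.swap)
    then show "trace_fmat \<tau> (M * N) = trace_fmat \<tau> (N * M)"
      by (simp add: trace_fmat_times[OF n(2,1)] tr_commute)
    show "trace_fmat \<tau> (star_fmat M) = cnj (trace_fmat \<tau> M)"
      using n by (simp add: trace_fmat_eq[of n] fits_fmat_simps entry_fmat_simps tr_star)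
    show "0 \<le> trace_fmat \<tau> (M * star_fmat M)"
      unfolding trace_fmat_star[OF n(1)]
      by (simp add: less_eq_complex_def sum_nonneg sqnorm_nonneg)
  qed
qed

sublocale fmat: traced_star_algebra scale_fmat star_fmat "trace_fmat \<tau>"
  by (rule traced_star_algebra_fmat)

lemma sqnorm_fmat:
  "fits n M \<Longrightarrow> fmat.sqnorm M = (\<Sum>i<n. \<Sum>k<n. sqnorm (entry M i k))"
  by (simp add: fmat.sqnorm_def trace_fmat_star)

text \<open>The constant is uniform in \<open>x\<close>, so that with \<open>b\<close> a column of a
  matrix it serves all rows \<open>x\<close> at once.\<close>

lemma sqnorm_sum_mult_bound:
  assumes "finite K"
  shows "\<exists>C\<ge>0. \<forall>x. sqnorm (\<Sum>k\<in>K. x k * b k) \<le> C * (\<Sum>k\<in>K. sqnorm (x k))"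
  using assms
proof induction
  case empty
  show ?case by (rule exI[of _ 0]) simp
next
  case (insert k K)
  then obtain C where C: "C \<ge> 0" "\<And>x. sqnorm (\<Sum>k\<in>K. x k * b k) \<le> C * (\<Sum>k\<in>K. sqnorm (x k))"
    by blast
  obtain D where D: "D \<ge> 0" "\<And>x. sqnorm (x * b k) \<le> D * sqnorm x"
    using right_bounded[of "b k"] unfolding right_bounded_def by blast
  have "sqnorm (\<Sum>k\<in>insert k K. x k * b k) \<le> (2 * C + 2 * D) * (\<Sum>k\<in>insert k K. sqnorm (x k))" for x
  proof -
    define s where "s = (\<Sum>k\<in>K. sqnorm (x k))"
    \<comment> \<open>These mixed terms make up the slack when the product on the right is
      expanded.\<close>
    have "0 \<le> D * s" "0 \<le> C * sqnorm (x k)"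
      using C(1) D(1) by (simp_all add: s_def sum_nonneg sqnorm_nonneg)
    then show ?thesis
      using insert.hyps sqnorm_add_le[of "x k * b k" "\<Sum>k\<in>K. x k * b k"] C(2)[of x] D(2)[of "x k"]
      by (simp add: s_def[symmetric] algebra_simps)
  qed
  with C(1) D(1) show ?case
    by (intro exI[of _ "2 * C + 2 * D"]) auto
qed

text \<open>Only finitely many columns of \<open>N\<close> are nonzero. Each has a bound
  \<open>C j\<close> valid for every row of \<open>M\<close>, and the sum of these does not depend
  on the size of \<open>M\<close>.\<close>

lemma right_bounded_fmat: "fmat.right_bounded N"
proof -
  obtain m where m: "fits m N"
    using fits_exists by blast
  have "\<forall>j. \<exists>C\<ge>0. \<forall>x. sqnorm (\<Sum>k<m. x k * entry N k j) \<le> C * (\<Sum>k<m. sqnorm (x k))"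
    by (intro allI sqnorm_sum_mult_bound) simp
  then obtain C where C: "\<And>j. C j \<ge> 0"
    and bd: "\<And>j x. sqnorm (\<Sum>k<m. x k * entry N k j) \<le> C j * (\<Sum>k<m. sqnorm (x k))"
    by metis
  have "fmat.sqnorm (M * N) \<le> (\<Sum>j<m. C j) * fmat.sqnorm M" for M
  proof -
    obtain n where "fits n M" "fits n N"
      by (rule fits_exists2)
    then have n: "fits (max m n) M" "fits (max m n) N"
      by (auto intro: fits_mono)
    have zero: "entry N k j = 0" if "\<not> j < m" for j k
      using fitsD[OF m] that by simp
    \<comment> \<open>In a single row, columns beyond \<open>m\<close> contribute nothing on the
      left and can only enlarge the right side.\<close>
    have "(\<Sum>j<max m n. sqnorm (entry (M * N) i j))
        \<le> (\<Sum>j<m. C j) * (\<Sum>k<max m n. sqnorm (entry M i k))" for i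
    proof -
      have "(\<Sum>j<max m n. sqnorm (entry (M * N) i j)) = (\<Sum>j<m. sqnorm (entry (M * N) i j))"
        by (rule sum.mono_neutral_right) (auto simp: entry_times_right[OF m] zero)
      also have "\<dots> \<le> (\<Sum>j<m. C j * (\<Sum>k<m. sqnorm (entry M i k)))"
        by (intro sum_mono) (simp add: entry_times_right[OF m] bd)
      also have "\<dots> = (\<Sum>j<m. C j) * (\<Sum>k<m. sqnorm (entry M i k))"
        by (simp add: sum_distrib_right)
      also have "\<dots> \<le> (\<Sum>j<m. C j) * (\<Sum>k<max m n. sqnorm (entry M i k))"
        by (intro mult_left_mono sum_mono2 sum_nonneg) (auto simp: C sqnorm_nonneg)
      finally show ?thesis .
    qed
    then show ?thesis
      unfolding sqnorm_fmat[OF n(1)] sqnorm_fmat[OF fits_fmat_simps(4)[OF n]] sum_distrib_left[of "\<Sum>j<m. C j" "\<lambda>i. \<Sum>k<max m n. sqnorm (entry M i k)"]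
      by (rule sum_mono)
  qed
  then show ?thesis
    unfolding fmat.right_bounded_def by (intro exI[of _ "\<Sum>j<m. C j"]) (simp add: C sum_nonneg)
qed

lemma faithful_fmat: "fmat.faithful (trace_fmat \<tau>)"
  unfolding fmat.faithful_def
proof (intro allI impI)
  fix M
  assume tr: "trace_fmat \<tau> (M * star_fmat M) = 0"
  obtain n where n: "fits n M"
    using fits_exists by blast
  have "(\<Sum>i<n. \<Sum>k<n. sqnorm (entry M i k)) = 0"
    using tr unfolding trace_fmat_star[OF n] by (simp only: of_real_eq_0_iff)
  then have zero: "entry M i k = 0" if "i < n" "k < n" for i k
    using that by (simp add: sum_nonneg_eq_0_iff sum_nonneg sqnorm_nonneg sqnorm_eq_0_iff)
  show "M = 0"
  proof (rule fmat_eqI)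
    fix i j
    show "entry M i j = entry 0 i j"
      using zero[of i j] fitsD[OF n, of i j] by (auto simp: entry_fmat_simps not_le[symmetric])
  qed
qed

text \<open>The matrices again carry a faithful trace with bounded right multiplications, so the
  Dedekind finiteness proved for the algebra applies to them.\<close>

lemma stably_finite_UNIV: "stably_finite (UNIV :: 'a set)"
proof (rule stably_finite_UNIV_if_dedekind_finite_fmat)
  interpret matrices: bounded_traced_star_algebra scale_fmat star_fmat "trace_fmat \<tau>"
    by unfold_locales (fact faithful_fmat right_bounded_fmat)+
  show "dedekind_finite (UNIV :: 'a fmat set)"
    by (rule matrices.dedekind_finite_UNIV)
qed

end

theorem theorem6p6:
  fixes scale :: "complex \<Rightarrow> 'a::ring \<Rightarrow> 'a"
    and star :: "'a \<Rightarrow> 'a"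
    and S :: "'a set"
    and \<tau> :: "'a \<Rightarrow> complex"
  assumes "star_algebra scale star"
    and "star_algebra.spanning_semigroup scale star S"
    and "star_algebra.contains_local_projections star S"
    and "star_algebra.trace scale star \<tau>"
    and "star_algebra.faithful star \<tau>"
    and "star_algebra.contractive star S \<tau>"
  shows "(\<forall>e. e * e = e \<and> e \<noteq> 0 \<longrightarrow> \<tau> e \<in> \<real> \<and> 0 < \<tau> e) \<and> stably_finite (UNIV :: 'a set)"
proof -
  interpret star_algebra scale star by fact
  interpret traced_star_algebra scale star \<tau>
    by unfold_locales fact
  \<comment> \<open>Here contractivity on the spanning semigroup supplies the bounds for all right
    multiplications.\<close>
  interpret bounded_traced_star_algebra scale star \<tau>
    by unfold_locales (use assms contractive_imp_right_bounded in auto)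
  show ?thesis
    \<comment> \<open>Realness of \<open>\<tau> e\<close> is part of \<open>0 < \<tau> e\<close> in
      the order on the complex numbers.\<close>
    using tr_idempotent_pos stably_finite_UNIV by (auto simp: less_complex_def complex_is_Real_iff)
qed

end
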